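(* Let $N\ge1$, let $\mathcal{A}$ be a finite set, and let $\mathbf{X}=(X_1,\dots,X_N)$ be the coordinate sequence on $\mathcal{A}^N$ under the probability measure $\mathbb{P}$ induced by transition kernels $\{p_j\}_{j=1}^N$. Let $V=\{1,\dots,N\}$ carry a directed forest structure in which each non-root node $j$ has a unique parent $\pi(j)$, with $\pi(j)<j$, and every node has at most $D$ children, where $D\ge1$ is an integer. Assume that: (i) for every non-root node $j$ and every history $x_{1:j-1}\in\mathcal{A}^{j-1}$, $p_j(\cdot\mid x_{1:j-1})=P_j(\cdot\mid x_{\pi(j)})$ for some kernel $P_j$ on $\mathcal{A}$, and for every root node $j$ the measure $p_j(\cdot\mid x_{1:j-1})$ does not depend on $x_{1:j-1}$; (ii) $H_{\pi(j),j}\le\alpha$ for every non-root node $j$, where $H$ is the causal interdependence matrix and $\alpha\ge0$ is a constant with $\alpha D<1$. Let $S_N=\sum_{i=1}^N f_i(X_i)$, where $f_i:\mathcal{A}\to\mathbb{R}$ satisfies $|f_i(a)-f_i(b)|\le 1$ for all $a,b\in\mathcal{A}$ and all $i=1,\dots,N$. Let $\Gamma=(I-H)^{-1}$ and let $\mathbf{1}_N=(1,\dots,1)^\top\in\mathbb{R}^N$. Then $$\|\Gamma\mathbf{1}_N\|_2^2\le\frac{N}{(1-\alpha D)^2},$$ and consequently, for every $t>0$, $$\mathbb{P}\bigl(|S_N-\mathbb{E}[S_N]|\ge t\bigr)\le 2\exp\left(-\frac{2t^2(1-\alpha D)^2}{N}\right).$$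
   Context: Setting. For each $i\in\{1,\dots,N\}$ and each history $x_{1:i-1}=(x_1,\dots,x_{i-1})\in\mathcal{A}^{i-1}$, $p_i(\cdot\mid x_{1:i-1})$ is a probability measure on the finite set $\mathcal{A}$ (kernels are specified for all histories; for $i=1$ the history is empty). The measure $\mathbb{P}$ on $\mathcal{A}^N$ is defined by $\mathbb{P}(X_{1:N}=x_{1:N})=\prod_{i=1}^N p_i(x_i\mid x_{1:i-1})$, where $X_i(x)=x_i$ are the coordinate projections. Total variation distance on $\mathcal{A}$: $d_{\mathrm{TV}}(\mu,\nu)=\frac12\sum_{a\in\mathcal{A}}|\mu(a)-\nu(a)|$. Causal interdependence matrix $H\in\mathbb{R}^{N\times N}$: $H_{i,j}=0$ for $i\ge j$, and for $1\le i<j\le N$, $$H_{i,j}=\max_{\mathbf{z}\in\mathcal{A}^{i-1},\ x,x'\in\mathcal{A},\ \mathbf{w}\in\mathcal{A}^{j-i-1}} d_{\mathrm{TV}}\bigl(p_j(\cdot\mid\mathbf{z},x,\mathbf{w}),\,p_j(\cdot\mid\mathbf{z},x',\mathbf{w})\bigr).$$ Since $H$ is strictly upper triangular, $I-H$ is invertible and $\Gamma=(I-H)^{-1}=\sum_{r=0}^{N-1}H^r$. $\|\cdot\|_2$ is the Euclidean norm. *)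

theory Defs
  imports "HOL-Probability.Probability" "Jordan_Normal_Form.Gauss_Jordan_Elimination"
    "Jordan_Normal_Form.Determinant"
begin

hide_const (open) Finite_Cartesian_Product.vec Finite_Cartesian_Product.row
  Finite_Cartesian_Product.mat Determinants.det

text \<open>
  The alphabet is a type \<open>'a :: finite\<close>. Sites are indexed from 0: the sites are \<open>0, \<dots>, N - 1\<close>,
  a configuration is a list of length \<open>N\<close>, and the history of site \<open>j\<close> is a list of length \<open>j\<close>.
  Hence \<open>p j h\<close> is the conditional law of the symbol at site \<open>j\<close> given the history \<open>h\<close>; only its
  values for \<open>j < N\<close> and \<open>length h = j\<close> are used below.
\<close>

definition path_prob :: "nat \<Rightarrow> (nat \<Rightarrow> 'a list \<Rightarrow> 'a pmf) \<Rightarrow> 'a list \<Rightarrow> real" where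
  "path_prob N p x = (if length x = N then \<Prod>i<N. pmf (p i (take i x)) (x ! i) else 0)"

text \<open>\<open>embed_pmf\<close> is only meaningful for functions of total mass 1; see \<open>pmf_path_law\<close> below.\<close>

definition path_law :: "nat \<Rightarrow> (nat \<Rightarrow> 'a :: finite list \<Rightarrow> 'a pmf) \<Rightarrow> 'a list pmf" where
  "path_law N p = embed_pmf (path_prob N p)"

definition tv_dist :: "'a :: finite pmf \<Rightarrow> 'a pmf \<Rightarrow> real" where
  "tv_dist \<mu> \<nu> = (1 / 2) * (\<Sum>a\<in>UNIV. \<bar>pmf \<mu> a - pmf \<nu> a\<bar>)"

definition interdep_mat :: "nat \<Rightarrow> (nat \<Rightarrow> 'a :: finite list \<Rightarrow> 'a pmf) \<Rightarrow> real mat" where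
  "interdep_mat N p = mat N N (\<lambda>(i, j).
     if i < j then
       Max {tv_dist (p j (z @ [x] @ w)) (p j (z @ [x'] @ w)) | z x x' w.
              length z = i \<and> length w = j - i - 1}
     else 0)"

text \<open>\<open>mat_inverse\<close> is \<open>None\<close> only on singular matrices; see \<open>Gamma_mat_inverse\<close> below.\<close>

definition Gamma_mat :: "nat \<Rightarrow> (nat \<Rightarrow> 'a :: finite list \<Rightarrow> 'a pmf) \<Rightarrow> real mat" where
  "Gamma_mat N p = the (mat_inverse (1\<^sub>m N - interdep_mat N p))"

definition vec_norm2 :: "real vec \<Rightarrow> real" where
  "vec_norm2 v = L2_set (\<lambda>i. vec_index v i) {..<dim_vec v}"

lemma path_prob_nonneg: "path_prob N p x \<ge> 0"
  by (auto simp: path_prob_def intro!: prod_nonneg)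

lemma path_prob_snoc:
  "path_prob (Suc N) p (xs @ [a]) = path_prob N p xs * pmf (p N xs) a"
proof (cases "length xs = N")
  case True
  have "(\<Prod>i<N. pmf (p i (take i (xs @ [a]))) ((xs @ [a]) ! i))
      = (\<Prod>i<N. pmf (p i (take i xs)) (xs ! i))"
    using True by (intro prod.cong) (auto simp: nth_append)
  then show ?thesis using True by (simp add: path_prob_def nth_append)
qed (simp add: path_prob_def)

lemma finite_length_lists: "finite {xs :: 'a :: finite list. length xs = n}"
  using finite_lists_length_eq[of "UNIV :: 'a set" n] by simp

lemma sum_path_prob:
  fixes p :: "nat \<Rightarrow> 'a :: finite list \<Rightarrow> 'a pmf"
  shows "(\<Sum>x | length x = N. path_prob N p x) = 1"
proof (induction N)
  case 0
  show ?case by (simp add: path_prob_def)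
next
  case (Suc N)
  let ?L = "{xs :: 'a list. length xs = N}"
  have inj: "inj_on (\<lambda>(xs, a). xs @ [a]) (?L \<times> UNIV)"
    by (auto simp: inj_on_def)
  have img: "{x :: 'a list. length x = Suc N} = (\<lambda>(xs, a). xs @ [a]) ` (?L \<times> UNIV)"
    by (auto simp: length_Suc_conv_rev image_iff)
  have "(\<Sum>x | length x = Suc N. path_prob (Suc N) p x)
      = (\<Sum>(xs, a)\<in>?L \<times> UNIV. path_prob (Suc N) p (xs @ [a]))"
    unfolding img by (subst sum.reindex[OF inj]) (simp add: case_prod_unfold)
  also have "\<dots> = (\<Sum>xs\<in>?L. \<Sum>a\<in>UNIV. path_prob N p xs * pmf (p N xs) a)"
    by (simp add: sum.cartesian_product path_prob_snoc)
  also have "\<dots> = (\<Sum>xs\<in>?L. path_prob N p xs)"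
    by (simp add: sum_distrib_left[symmetric] sum_pmf_eq_1)
  finally show ?case using Suc.IH by simp
qed

lemma pmf_path_law:
  fixes p :: "nat \<Rightarrow> 'a :: finite list \<Rightarrow> 'a pmf"
  shows "pmf (path_law N p) x = path_prob N p x"
  unfolding path_law_def
proof (rule pmf_embed_pmf[OF path_prob_nonneg])
  let ?L = "{xs :: 'a list. length xs = N}"
  have "(\<integral>\<^sup>+ x. ennreal (path_prob N p x) \<partial>count_space UNIV)
      = (\<integral>\<^sup>+ x. ennreal (path_prob N p x) * indicator ?L x \<partial>count_space UNIV)"
    by (intro nn_integral_cong) (auto simp: path_prob_def indicator_def)
  also have "\<dots> = (\<Sum>x\<in>?L. ennreal (path_prob N p x))"
    by (simp add: nn_integral_count_space_indicator[symmetric] nn_integral_count_space_finite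
        finite_length_lists)
  also have "\<dots> = 1"
    by (simp add: sum_ennreal path_prob_nonneg sum_path_prob)
  finally show "(\<integral>\<^sup>+ x. ennreal (path_prob N p x) \<partial>count_space UNIV) = 1" .
qed

lemma Gamma_mat_inverse:
  fixes p :: "nat \<Rightarrow> 'a :: finite list \<Rightarrow> 'a pmf"
  shows "Gamma_mat N p \<in> carrier_mat N N"
    and "(1\<^sub>m N - interdep_mat N p) * Gamma_mat N p = 1\<^sub>m N"
    and "Gamma_mat N p * (1\<^sub>m N - interdep_mat N p) = 1\<^sub>m N"
proof -
  let ?A = "1\<^sub>m N - interdep_mat N p"
  have A: "?A \<in> carrier_mat N N"
    by (rule minus_carrier_mat) (simp add: interdep_mat_def)
  have "upper_triangular ?A"
    by (rule upper_triangularI) (auto simp: interdep_mat_def)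
  moreover have "diag_mat ?A = replicate N 1"
    by (auto simp: diag_mat_def interdep_mat_def intro!: nth_equalityI)
  ultimately have "Determinant.det ?A = 1"
    using det_upper_triangular[OF _ A] by simp
  then have "?A \<in> Units (ring_mat TYPE(real) N ())"
    by (intro det_non_zero_imp_unit[OF A]) simp
  then obtain B where B: "mat_inverse ?A = Some B"
    using mat_inverse(1)[OF A, where b = "()"] by (cases "mat_inverse ?A") auto
  show "Gamma_mat N p \<in> carrier_mat N N" "?A * Gamma_mat N p = 1\<^sub>m N"
    "Gamma_mat N p * ?A = 1\<^sub>m N"
    using mat_inverse(2)[OF A B] B by (auto simp: Gamma_mat_def)
qed

end

theory Submission
  imports Defs
begin

text \<open>
  The vector \<open>g = \<Gamma> c\<close> solves the recursion \<open>g i = c i + (\<Sum>j. H i j * g j)\<close>. If \<open>S\<close> changes by at most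
  \<open>c i\<close> when site \<open>i\<close> is changed, then averaging out the sites \<open>N - 1, \<dots>, k\<close> one after the other
  gives a function of the history of length \<open>k\<close> that changes by at most
  \<open>c i + (\<Sum>j\<ge>k. H i j * g j)\<close>: averaging out site \<open>j\<close> costs the oscillation \<open>g j\<close> at that site times the
  total variation distance \<open>H i j\<close> between its conditional laws. With \<open>k = i + 1\<close>, the
  \<open>i\<close>-th martingale difference of \<open>S\<close> has conditional range at most \<open>g i\<close>, and Hoeffding's lemma together with
  Chernoff's bound gives the tail estimate. On a forest \<open>H i j\<close> vanishes unless \<open>i\<close> is the
  parent of \<open>j\<close>, so the row sums of \<open>H\<close> are at most \<open>\<alpha> D\<close> and every entry of \<open>\<Gamma> 1\<close> is at most
  \<open>1 / (1 - \<alpha> D)\<close>.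
\<close>

section \<open>Expectations and total variation on a finite alphabet\<close>

lemma expectation_eq_sum_UNIV:
  fixes \<phi> :: "'a :: finite \<Rightarrow> real"
  shows "measure_pmf.expectation \<mu> \<phi> = (\<Sum>a\<in>UNIV. pmf \<mu> a * \<phi> a)"
  by (simp add: integral_measure_pmf[of UNIV])

lemma integrable_finite_pmf [simp]:
  fixes \<phi> :: "'a :: finite \<Rightarrow> real"
  shows "integrable (measure_pmf \<mu>) \<phi>"
  by (simp add: integrable_measure_pmf_finite)

lemma tv_dist_nonneg: "tv_dist \<mu> \<nu> \<ge> 0"
  by (simp add: tv_dist_def sum_nonneg)

lemma tv_dist_self [simp]: "tv_dist \<mu> \<mu> = 0"
  by (simp add: tv_dist_def)

text \<open>The difference of two probability measures has total mass zero, so \<phi> may be shifted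
  by the midpoint \<open>c\<close> of its range. What remains is at most \<open>r / 2\<close> in
  absolute value, and this half is the one in \<open>tv_dist\<close>.\<close>

lemma expectation_diff_le_tv_dist:
  fixes \<mu> \<nu> :: "'a :: finite pmf" and \<phi> :: "'a \<Rightarrow> real"
  assumes osc: "\<And>a b. \<phi> a - \<phi> b \<le> r"
  shows "\<bar>measure_pmf.expectation \<mu> \<phi> - measure_pmf.expectation \<nu> \<phi>\<bar> \<le> tv_dist \<mu> \<nu> * r"
proof -
  define M where "M = Max (range \<phi>)"
  define m where "m = Min (range \<phi>)"
  define c where "c = (M + m) / 2"
  have "M \<in> range \<phi>" "m \<in> range \<phi>"
    unfolding M_def m_def by (intro Max_in Min_in; simp)+
  then have "M - m \<le> r" using osc by auto
  moreover have "\<phi> a \<le> M" "m \<le> \<phi> a" for a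
    by (auto simp: M_def m_def)
  ultimately have "M - m \<le> r \<and> \<phi> a \<le> M \<and> m \<le> \<phi> a" for a
    by blast
  then have c: "\<bar>\<phi> a - c\<bar> \<le> r / 2" for a
    by (auto simp: c_def abs_le_iff field_simps) (smt (verit))+
  have "(\<Sum>a\<in>UNIV. (pmf \<mu> a - pmf \<nu> a) * c) = 0"
    by (simp add: sum_distrib_right[symmetric] sum_subtractf sum_pmf_eq_1)
  then have "measure_pmf.expectation \<mu> \<phi> - measure_pmf.expectation \<nu> \<phi>
      = (\<Sum>a\<in>UNIV. (pmf \<mu> a - pmf \<nu> a) * (\<phi> a - c))"
    by (simp add: expectation_eq_sum_UNIV right_diff_distrib left_diff_distrib sum_subtractf)
  also have "\<bar>\<dots>\<bar> \<le> (\<Sum>a\<in>UNIV. \<bar>pmf \<mu> a - pmf \<nu> a\<bar> * (r / 2))"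
    by (intro order.trans[OF sum_abs] sum_mono) (unfold abs_mult, intro mult_left_mono c abs_ge_zero)
  also have "\<dots> = tv_dist \<mu> \<nu> * r"
    by (simp add: tv_dist_def flip: sum_distrib_right sum_divide_distrib)
  finally show ?thesis .
qed

section \<open>The path law built up site by site, and iterated averaging\<close>

lemma path_law_0 [simp]: "path_law 0 p = return_pmf []"
  by (rule pmf_eqI) (simp add: pmf_path_law path_prob_def pmf_return indicator_def)

text \<open>The monadic form turns integrals against the path law into iterated ones: first over the
  new symbol, then over its history.\<close>

lemma path_law_Suc:
  "path_law (Suc N) p = path_law N p \<bind> (\<lambda>x. map_pmf (\<lambda>a. x @ [a]) (p N x))"
proof (rule pmf_eqI)
  fix y :: "'a list"
  show "pmf (path_law (Suc N) p) y
      = pmf (path_law N p \<bind> (\<lambda>x. map_pmf (\<lambda>a. x @ [a]) (p N x))) y"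
  proof (cases y rule: rev_cases)
    case Nil
    then show ?thesis
      by (auto simp: pmf_path_law path_prob_def pmf_eq_0_set_pmf)
  next
    case (snoc x a)
    \<comment> \<open>A list ending in \<open>a\<close> determines its history, so only
      \<open>x' = x\<close> contributes to the bind.\<close>
    have "pmf (map_pmf (\<lambda>b. x' @ [b]) (p N x')) y = indicator {x} x' * pmf (p N x) a" for x'
    proof (cases "x' = x")
      case True
      then show ?thesis
        using pmf_map_inj'[of "\<lambda>b. x @ [b]" "p N x" a] snoc by (simp add: inj_def)
    qed (use snoc in \<open>auto simp: pmf_eq_0_set_pmf\<close>)
    then show ?thesis
      using snoc by (simp add: pmf_bind pmf_path_law path_prob_snoc measure_pmf_single)
  qed
qed

lemma length_path_law: "x \<in> set_pmf (path_law N p) \<Longrightarrow> length x = N"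
  by (auto simp: set_pmf_iff pmf_path_law path_prob_def split: if_splits)

lemma finite_set_path_law [simp]: "finite (set_pmf (path_law N p))"
  by (rule finite_subset[OF _ finite_length_lists[of N]]) (auto dest: length_path_law)

lemma expectation_path_law_Suc:
  fixes \<phi> :: "'a :: finite list \<Rightarrow> real"
  shows "measure_pmf.expectation (path_law (Suc N) p) \<phi>
    = measure_pmf.expectation (path_law N p)
        (\<lambda>x. measure_pmf.expectation (p N x) (\<lambda>a. \<phi> (x @ [a])))"
  unfolding path_law_Suc
  by (subst pmf_expectation_bind[OF finite_set_path_law[of N p]])
     (auto simp: integral_measure_pmf[OF finite_set_path_law[of N p]])

text \<open>Here \<open>n\<close> counts the sites still to be averaged out, so it goes with histories of length \<open>N - n\<close>.\<close>

primrec cond_exp :: "(nat \<Rightarrow> 'a :: finite list \<Rightarrow> 'a pmf) \<Rightarrow> ('a list \<Rightarrow> real) \<Rightarrow> nat \<Rightarrow> 'a list \<Rightarrow> real"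
where
  "cond_exp p S 0 h = S h"
| "cond_exp p S (Suc n) h
     = measure_pmf.expectation (p (length h) h) (\<lambda>a. cond_exp p S n (h @ [a]))"

text \<open>Tower property. Each induction step trades the last site of the path law for one more
  averaging in \<open>cond_exp\<close>, so \<open>n\<close> has to vary.\<close>

lemma expectation_path_law_cond_exp:
  "measure_pmf.expectation (path_law k p) (cond_exp p S n) = cond_exp p S (k + n) []"
proof (induction k arbitrary: n)
  case (Suc k)
  have "measure_pmf.expectation (path_law (Suc k) p) (cond_exp p S n)
      = measure_pmf.expectation (path_law k p) (cond_exp p S (Suc n))"
    unfolding expectation_path_law_Suc
    by (intro integral_cong_AE) (auto simp: AE_measure_pmf_iff dest: length_path_law)
  then show ?case using Suc.IH[of "Suc n"] by simp
qed simp

lemma cond_exp_eq_expectation: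
  "cond_exp p S N [] = measure_pmf.expectation (path_law N p) S"
proof -
  have "cond_exp p S 0 = S" by (rule ext) simp
  then show ?thesis using expectation_path_law_cond_exp[of N p S 0] by simp
qed

section \<open>Entries of the interdependence matrix and the recursion for \<Gamma>\<close>

text \<open>A quadruple \<open>(z, x, x', w)\<close> is the same as a history \<open>h\<close>
  together with a new symbol \<open>b\<close> for position \<open>i\<close>. This form shows that
  the set is finite and matches the one-site perturbations used later.\<close>

lemma interdep_mat_eq_Max:
  assumes "i < j" "j < N"
  shows "interdep_mat N p $$ (i, j)
    = Max ((\<lambda>(h, b). tv_dist (p j h) (p j (h[i := b]))) ` ({h. length h = j} \<times> UNIV))"
proof -
  let ?T = "{tv_dist (p j (z @ [x] @ w)) (p j (z @ [x'] @ w)) | z x x' w.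
              length z = i \<and> length w = j - i - 1}"
  let ?U = "(\<lambda>(h, b). tv_dist (p j h) (p j (h[i := b]))) ` ({h. length h = j} \<times> UNIV)"
  have "?T = ?U"
  proof (intro equalityI subsetI)
    fix t assume "t \<in> ?T"
    then obtain z x x' w where t: "t = tv_dist (p j (z @ [x] @ w)) (p j (z @ [x'] @ w))"
      "length z = i" "length w = j - i - 1" by blast
    then show "t \<in> ?U"
      using assms by (intro image_eqI[where x = "(z @ [x] @ w, x')"]) (auto simp: list_update_append)
  next
    fix t assume "t \<in> ?U"
    then obtain h b where t: "t = tv_dist (p j h) (p j (h[i := b]))" "length h = j" by auto
    have "h = take i h @ [h ! i] @ drop (Suc i) h"
      using t assms by (simp add: id_take_nth_drop[symmetric])
    moreover have "h[i := b] = take i h @ [b] @ drop (Suc i) h"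
      using t assms by (simp add: upd_conv_take_nth_drop)
    ultimately have "t = tv_dist (p j (take i h @ [h ! i] @ drop (Suc i) h))
        (p j (take i h @ [b] @ drop (Suc i) h))"
      using t(1) by simp
    moreover have "length (take i h) = i" "length (drop (Suc i) h) = j - i - 1"
      using t assms by auto
    ultimately show "t \<in> ?T" by blast
  qed
  then show ?thesis using assms by (simp add: interdep_mat_def)
qed

lemma tv_dist_le_interdep_mat:
  assumes "i < j" "j < N" "length h = j"
  shows "tv_dist (p j h) (p j (h[i := b])) \<le> interdep_mat N p $$ (i, j)"
  unfolding interdep_mat_eq_Max[OF assms(1,2)] using assms(3)
  by (intro Max_ge finite_imageI finite_cartesian_product finite_length_lists finite)
     (auto intro!: image_eqI[where x = "(h, b)"])

lemma interdep_mat_le: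
  assumes "i < j" "j < N"
    and "\<And>(h :: 'a :: finite list) b. length h = j \<Longrightarrow> tv_dist (p j h) (p j (h[i := b])) \<le> c"
  shows "interdep_mat N p $$ (i, j) \<le> c"
proof -
  \<comment> \<open>\<open>Max\<close> needs a nonempty set, so some history has to be
    exhibited.\<close>
  have "replicate j undefined \<in> {h :: 'a list. length h = j}" by simp
  then have "{h :: 'a list. length h = j} \<noteq> {}" by blast
  then show ?thesis
    unfolding interdep_mat_eq_Max[OF assms(1,2)] using assms(3)
    by (intro Max.boundedI finite_imageI finite_cartesian_product finite_length_lists finite) auto
qed

lemma interdep_mat_nonneg:
  assumes "i < N" "j < N"
  shows "interdep_mat N p $$ (i, j) \<ge> 0"
proof (cases "i < j")
  case True
  show ?thesis
    by (rule order.trans[OF tv_dist_nonneg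
          tv_dist_le_interdep_mat[OF True assms(2) length_replicate]])
qed (use assms in \<open>simp add: interdep_mat_def\<close>)

text \<open>This is row \<open>i\<close> of \<open>(I - H) (\<Gamma> c) = c\<close>, the form in
  which \<Gamma> enters all later estimates.\<close>

lemma Gamma_mat_mult_index:
  assumes c: "c \<in> carrier_vec N" and i: "i < N"
  shows "(Gamma_mat N p *\<^sub>v c) $ i
    = c $ i + (\<Sum>j<N. interdep_mat N p $$ (i, j) * (Gamma_mat N p *\<^sub>v c) $ j)"
proof -
  let ?G = "Gamma_mat N p" and ?H = "interdep_mat N p"
  have H: "?H \<in> carrier_mat N N" by (simp add: interdep_mat_def)
  have g: "?G *\<^sub>v c \<in> carrier_vec N"
    using Gamma_mat_inverse(1)[of N p] c by simp
  have mult_index: "(?H *\<^sub>v v) $ i = (\<Sum>j<N. ?H $$ (i, j) * v $ j)" if "v \<in> carrier_vec N" for v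
    using that H i by (simp add: scalar_prod_def atLeast0LessThan)
  have "(1\<^sub>m N - ?H) *\<^sub>v (?G *\<^sub>v c) = ((1\<^sub>m N - ?H) * ?G) *\<^sub>v c"
    by (rule assoc_mult_mat_vec[symmetric, OF minus_carrier_mat[OF H] Gamma_mat_inverse(1) c])
  also have "\<dots> = c"
    using c by (simp only: Gamma_mat_inverse(2) one_mult_mat_vec)
  finally have "(1\<^sub>m N - ?H) *\<^sub>v (?G *\<^sub>v c) = c" .
  then have "?G *\<^sub>v c - ?H *\<^sub>v (?G *\<^sub>v c) = c"
    using g H by (simp add: minus_mult_distrib_mat_vec[of _ N N])
  then have "c $ i = (?G *\<^sub>v c - ?H *\<^sub>v (?G *\<^sub>v c)) $ i" by simp
  also have "\<dots> = (?G *\<^sub>v c) $ i - (?H *\<^sub>v (?G *\<^sub>v c)) $ i"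
    using H i by simp
  also have "(?H *\<^sub>v (?G *\<^sub>v c)) $ i = (\<Sum>j<N. ?H $$ (i, j) * (?G *\<^sub>v c) $ j)"
    by (rule mult_index[OF g])
  finally show ?thesis by simp
qed

lemma sum_interdep_mat_row:
  assumes "i < N"
  shows "(\<Sum>j<N. interdep_mat N p $$ (i, j) * g j)
    = (\<Sum>j\<in>{Suc i..<N}. interdep_mat N p $$ (i, j) * g j)"
  using assms by (intro sum.mono_neutral_right) (auto simp: interdep_mat_def)

section \<open>Oscillation of the partially averaged function\<close>

text \<open>Averaging out site \<open>k = length h\<close> splits the change into two terms: the
  same kernel with two integrands, bounded by the induction hypothesis at \<open>i\<close>, and the
  same integrand under two kernels, bounded by \<open>H i k * g k\<close>. The latter is the new
  summand \<open>j = k\<close>.\<close>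

lemma cond_exp_osc:
  assumes S: "\<And>i x b. i < N \<Longrightarrow> length x = N \<Longrightarrow> \<bar>S x - S (x[i := b])\<bar> \<le> c i"
    and g: "\<And>i. i < N \<Longrightarrow> g i = c i + (\<Sum>j<N. interdep_mat N p $$ (i, j) * g j)"
    and "length h + n = N" "i < length h"
  shows "\<bar>cond_exp p S n h - cond_exp p S n (h[i := b])\<bar>
    \<le> c i + (\<Sum>j\<in>{length h..<N}. interdep_mat N p $$ (i, j) * g j)"
  using assms(3,4)
proof (induction n arbitrary: h i b)
  case 0
  then show ?case using S by simp
next
  case (Suc n)
  let ?k = "length h" and ?H = "interdep_mat N p" and ?h' = "h[i := b]"
  have k: "?k < N" using Suc.prems by simp
  have IH: "\<bar>cond_exp p S n (h' @ [a]) - cond_exp p S n ((h' @ [a])[l := b'])\<bar>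
      \<le> c l + (\<Sum>j\<in>{Suc ?k..<N}. ?H $$ (l, j) * g j)" if "length h' = ?k" "l \<le> ?k" for h' a l b'
    using Suc.IH[of "h' @ [a]" l b'] Suc.prems that by simp
  let ?V = "\<lambda>h a. cond_exp p S n (h @ [a])"
  have A: "\<bar>?V h a - ?V ?h' a\<bar> \<le> c i + (\<Sum>j\<in>{Suc ?k..<N}. ?H $$ (i, j) * g j)" for a
    using IH[of h i a b] Suc.prems by (simp add: list_update_append)
  have gk: "g ?k = c ?k + (\<Sum>j\<in>{Suc ?k..<N}. ?H $$ (?k, j) * g j)"
    using g[OF k] unfolding sum_interdep_mat_row[OF k] .
  \<comment> \<open>The induction hypothesis at position \<open>?k\<close> itself: row
    \<open>?k\<close> of \<open>H\<close> vanishes up to the diagonal, so the bound is all of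
    \<open>g ?k\<close>.\<close>
  have osc: "?V ?h' a - ?V ?h' a' \<le> g ?k" for a a'
    using IH[of ?h' ?k a a'] gk by (simp add: list_update_append)
  \<comment> \<open>Nonnegativity of \<open>g ?k\<close> comes from comparing a symbol with itself;
    it is needed to replace the total variation distance by the matrix entry.\<close>
  have g0: "g ?k \<ge> 0" using osc[of a a for a] by simp
  let ?E = "\<lambda>h. measure_pmf.expectation (p ?k h)"
  have "\<bar>?E h (?V h) - ?E h (?V ?h')\<bar> = \<bar>?E h (\<lambda>a. ?V h a - ?V ?h' a)\<bar>"
    by simp
  also have "\<dots> \<le> ?E h (\<lambda>a. \<bar>?V h a - ?V ?h' a\<bar>)"
    by (rule integral_abs_bound)
  also have "\<dots> \<le> c i + (\<Sum>j\<in>{Suc ?k..<N}. ?H $$ (i, j) * g j)"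
    by (intro measure_pmf.integral_le_const) (use A in auto)
  finally have 1: "\<bar>?E h (?V h) - ?E h (?V ?h')\<bar>
      \<le> c i + (\<Sum>j\<in>{Suc ?k..<N}. ?H $$ (i, j) * g j)" .
  have "\<bar>?E h (?V ?h') - ?E ?h' (?V ?h')\<bar> \<le> tv_dist (p ?k h) (p ?k ?h') * g ?k"
    by (rule expectation_diff_le_tv_dist[OF osc])
  also have "\<dots> \<le> ?H $$ (i, ?k) * g ?k"
    using Suc.prems k by (intro mult_right_mono tv_dist_le_interdep_mat g0) auto
  finally have 2: "\<bar>?E h (?V ?h') - ?E ?h' (?V ?h')\<bar> \<le> ?H $$ (i, ?k) * g ?k" .
  have "(\<Sum>j\<in>{?k..<N}. ?H $$ (i, j) * g j)
      = ?H $$ (i, ?k) * g ?k + (\<Sum>j\<in>{Suc ?k..<N}. ?H $$ (i, j) * g j)"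
    using k by (rule sum.atLeast_Suc_lessThan)
  then show ?case using 1 2 by simp
qed

section \<open>Exponential moments and tail bounds\<close>

text \<open>The values lie in \<open>[m, m + r]\<close> with \<open>m\<close> the minimum, so
  Hoeffding's lemma applies to the centred variable; the factor \<open>exp (l * ?e)\<close> undoes
  the centring. Nonnegative integrals avoid integrability conditions.\<close>

lemma Hoeffding_pmf:
  fixes \<mu> :: "'a :: finite pmf" and \<phi> :: "'a \<Rightarrow> real"
  assumes osc: "\<And>a b. \<phi> a - \<phi> b \<le> r" and l: "l > 0"
  shows "(\<integral>\<^sup>+a. ennreal (exp (l * \<phi> a)) \<partial>measure_pmf \<mu>)
    \<le> ennreal (exp (l * measure_pmf.expectation \<mu> \<phi> + l\<^sup>2 * r\<^sup>2 / 8))"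
proof -
  define m where "m = Min (range \<phi>)"
  let ?e = "measure_pmf.expectation \<mu> \<phi>"
  have "m \<in> range \<phi>"
    unfolding m_def by (intro Min_in; simp)
  then have up: "\<phi> a \<le> m + r" for a
    using osc[of a] by (auto simp: algebra_simps)
  have lo: "m \<le> \<phi> a" for a
    by (simp add: m_def)
  interpret interval_bounded_random_variable "measure_pmf \<mu>" \<phi> m "m + r"
    by unfold_locales (use up lo in auto)
  have "(\<integral>\<^sup>+a. ennreal (exp (l * \<phi> a)) \<partial>measure_pmf \<mu>)
      = (\<integral>\<^sup>+a. ennreal (exp (l * ?e)) * ennreal (exp (l * (\<phi> a - ?e))) \<partial>measure_pmf \<mu>)"
    by (simp add: ennreal_mult[symmetric] exp_add[symmetric] algebra_simps)
  also have "\<dots> = ennreal (exp (l * ?e))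
      * (\<integral>\<^sup>+a. ennreal (exp (l * (\<phi> a - ?e))) \<partial>measure_pmf \<mu>)"
    by (rule nn_integral_cmult) simp
  also have "\<dots> \<le> ennreal (exp (l * ?e)) * ennreal (exp (l\<^sup>2 * (m + r - m)\<^sup>2 / 8))"
    by (intro mult_left_mono Hoeffdings_lemma_nn_integral l) simp
  also have "\<dots> = ennreal (exp (l * ?e + l\<^sup>2 * r\<^sup>2 / 8))"
    by (simp add: ennreal_mult[symmetric] exp_add)
  finally show ?thesis .
qed

text \<open>Given the first \<open>k\<close> symbols, Hoeffding's lemma at site \<open>k\<close>
  costs a factor that does not depend on the history and so leaves the integral. For
  \<open>k = N\<close> this bounds the moment generating function of \<open>S\<close>.\<close>

lemma path_law_mgf_le:
  assumes osc: "\<And>h a b. length h < N \<Longrightarrow>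
      cond_exp p S (N - Suc (length h)) (h @ [a]) - cond_exp p S (N - Suc (length h)) (h @ [b])
        \<le> g (length h)"
    and "l > 0" "k \<le> N"
  shows "(\<integral>\<^sup>+x. ennreal (exp (l * cond_exp p S (N - k) x)) \<partial>measure_pmf (path_law k p))
    \<le> ennreal (exp (l * cond_exp p S N [] + l\<^sup>2 * (\<Sum>i<k. (g i)\<^sup>2) / 8))"
  using \<open>k \<le> N\<close>
proof (induction k)
  case 0
  then show ?case by simp
next
  case (Suc k)
  let ?C = "ennreal (exp (l\<^sup>2 * (g k)\<^sup>2 / 8))"
  have k: "N - k = Suc (N - Suc k)" using Suc.prems by simp
  have "(\<integral>\<^sup>+x. ennreal (exp (l * cond_exp p S (N - Suc k) x)) \<partial>measure_pmf (path_law (Suc k) p))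
      = (\<integral>\<^sup>+x. (\<integral>\<^sup>+a. ennreal (exp (l * cond_exp p S (N - Suc k) (x @ [a])))
          \<partial>measure_pmf (p k x)) \<partial>measure_pmf (path_law k p))"
    unfolding path_law_Suc by simp
  also have "\<dots> \<le> (\<integral>\<^sup>+x. ennreal (exp (l * cond_exp p S (N - k) x)) * ?C
      \<partial>measure_pmf (path_law k p))"
  proof (rule nn_integral_mono_AE, rule AE_pmfI)
    fix x assume "x \<in> set_pmf (path_law k p)"
    then have x: "length x = k" by (rule length_path_law)
    have "(\<integral>\<^sup>+a. ennreal (exp (l * cond_exp p S (N - Suc k) (x @ [a]))) \<partial>measure_pmf (p k x))
      \<le> ennreal (exp (l * measure_pmf.expectation (p k x)
            (\<lambda>a. cond_exp p S (N - Suc k) (x @ [a])) + l\<^sup>2 * (g k)\<^sup>2 / 8))"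
      using osc[of x] x Suc.prems \<open>l > 0\<close> by (intro Hoeffding_pmf) auto
    also have "\<dots> = ennreal (exp (l * cond_exp p S (N - k) x)) * ?C"
      by (simp add: k x exp_add ennreal_mult)
    finally show "(\<integral>\<^sup>+a. ennreal (exp (l * cond_exp p S (N - Suc k) (x @ [a]))) \<partial>measure_pmf (p k x))
      \<le> ennreal (exp (l * cond_exp p S (N - k) x)) * ?C" .
  qed
  also have "\<dots> = (\<integral>\<^sup>+x. ennreal (exp (l * cond_exp p S (N - k) x)) \<partial>measure_pmf (path_law k p)) * ?C"
    by (rule nn_integral_multc) simp
  also have "\<dots> \<le> ennreal (exp (l * cond_exp p S N [] + l\<^sup>2 * (\<Sum>i<k. (g i)\<^sup>2) / 8)) * ?C"
    using Suc by (intro mult_right_mono) auto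
  also have "\<dots> = ennreal (exp (l * cond_exp p S N [] + l\<^sup>2 * (\<Sum>i<Suc k. (g i)\<^sup>2) / 8))"
    by (simp add: ennreal_mult[symmetric] exp_add[symmetric] algebra_simps add_divide_distrib)
  finally show ?case .
qed

lemma vec_norm2_sq: "v \<in> carrier_vec N \<Longrightarrow> (vec_norm2 v)\<^sup>2 = (\<Sum>i<N. (v $ i)\<^sup>2)"
  by (simp add: vec_norm2_def L2_set_def sum_nonneg)

text \<open>Here \<open>v\<close> is any positive bound for the squared norm, so that an explicit
  constant can be inserted and the quotient has a positive denominator.\<close>

lemma path_law_upper_tail:
  assumes c: "c \<in> carrier_vec N"
    and S: "\<And>i x b. i < N \<Longrightarrow> length x = N \<Longrightarrow> \<bar>S x - S (x[i := b])\<bar> \<le> c $ i"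
    and v: "(vec_norm2 (Gamma_mat N p *\<^sub>v c))\<^sup>2 \<le> v" "v > 0" and t: "t > 0"
  shows "measure_pmf.prob (path_law N p)
      {x. S x - measure_pmf.expectation (path_law N p) S \<ge> t} \<le> exp (- (2 * t\<^sup>2 / v))"
proof -
  define g where "g = Gamma_mat N p *\<^sub>v c"
  have g_carrier: "g \<in> carrier_vec N"
    using Gamma_mat_inverse(1)[of N p] c by (simp add: g_def)
  have g_eq: "g $ i = c $ i + (\<Sum>j<N. interdep_mat N p $$ (i, j) * g $ j)" if "i < N" for i
    unfolding g_def by (rule Gamma_mat_mult_index[OF c that])
  \<comment> \<open>The histories have length \<open>Suc ?k\<close> and differ at most at
    \<open>?k\<close>, so the sum in \<open>cond_exp_osc\<close> starts just after the diagonal and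
    the bound is exactly \<open>g $ ?k\<close>.\<close>
  have osc: "cond_exp p S (N - Suc (length h)) (h @ [a]) - cond_exp p S (N - Suc (length h)) (h @ [b])
      \<le> g $ length h" if "length h < N" for h a b
  proof -
    let ?k = "length h"
    have "\<bar>cond_exp p S (N - Suc ?k) (h @ [a]) - cond_exp p S (N - Suc ?k) ((h @ [a])[?k := b])\<bar>
        \<le> c $ ?k + (\<Sum>j\<in>{length (h @ [a])..<N}. interdep_mat N p $$ (?k, j) * g $ j)"
      by (rule cond_exp_osc[OF S g_eq]) (use that in auto)
    also have "\<dots> = g $ ?k"
      using g_eq[OF that] unfolding sum_interdep_mat_row[OF that] by simp
    finally show ?thesis by (simp add: list_update_append)
  qed
  let ?e = "measure_pmf.expectation (path_law N p) S"
  \<comment> \<open>This value minimises \<open>l\<^sup>2 * v / 8 - l * t\<close>; the minimum is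
    \<open>- (2 * t\<^sup>2 / v)\<close>.\<close>
  define l where "l = 4 * t / v"
  have l: "l > 0" using v t by (simp add: l_def)
  let ?M = "measure_pmf (path_law N p)"
  have "emeasure ?M {x. S x - ?e \<ge> t} = emeasure ?M {x \<in> space ?M. S x - ?e \<ge> t}"
    by simp
  also have "\<dots> \<le> ennreal (exp (- l * t))
      * (\<integral>\<^sup>+x\<in>space ?M. ennreal (exp (l * (S x - ?e))) \<partial>?M)"
    by (intro Chernoff_ineq_nn_integral_ge l) auto
  also have "(\<integral>\<^sup>+x\<in>space ?M. ennreal (exp (l * (S x - ?e))) \<partial>?M)
      = (\<integral>\<^sup>+x. ennreal (exp (- (l * ?e))) * ennreal (exp (l * S x)) \<partial>?M)"
    by (simp add: ennreal_mult[symmetric] exp_add[symmetric] algebra_simps)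
  also have "\<dots> = ennreal (exp (- (l * ?e))) * (\<integral>\<^sup>+x. ennreal (exp (l * S x)) \<partial>?M)"
    by (rule nn_integral_cmult) simp
  also have "ennreal (exp (- l * t)) * \<dots> \<le> ennreal (exp (- l * t)) * (ennreal (exp (- (l * ?e)))
      * ennreal (exp (l * ?e + l\<^sup>2 * (\<Sum>i<N. (g $ i)\<^sup>2) / 8)))"
    using path_law_mgf_le[where g = "($) g", OF osc l order.refl]
    by (intro mult_left_mono) (auto simp: cond_exp_eq_expectation)
  also have "\<dots> = ennreal (exp (l\<^sup>2 * (\<Sum>i<N. (g $ i)\<^sup>2) / 8 - l * t))"
    by (simp add: ennreal_mult[symmetric] exp_add[symmetric])
  also have "\<dots> \<le> ennreal (exp (l\<^sup>2 * v / 8 - l * t))"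
    using v(1) by (intro ennreal_leI) (simp add: g_def[symmetric] vec_norm2_sq[OF g_carrier] mult_left_mono)
  also have "l\<^sup>2 * v / 8 - l * t = - (2 * t\<^sup>2 / v)"
    using v(2) by (simp add: l_def power2_eq_square field_simps)
  finally show ?thesis
    by (simp add: measure_pmf.emeasure_eq_measure)
qed

text \<open>A union bound over the upper tails of \<open>S\<close> and \<open>- S\<close>, which
  satisfy the same oscillation bounds.\<close>

theorem path_law_concentration:
  assumes c: "c \<in> carrier_vec N"
    and S: "\<And>i x b. i < N \<Longrightarrow> length x = N \<Longrightarrow> \<bar>S x - S (x[i := b])\<bar> \<le> c $ i"
    and v: "(vec_norm2 (Gamma_mat N p *\<^sub>v c))\<^sup>2 \<le> v" "v > 0" and t: "t > 0"
  shows "measure_pmf.prob (path_law N p)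
      {x. \<bar>S x - measure_pmf.expectation (path_law N p) S\<bar> \<ge> t} \<le> 2 * exp (- (2 * t\<^sup>2 / v))"
proof -
  let ?M = "path_law N p"
  let ?e = "measure_pmf.expectation ?M S"
  have "{x. \<bar>S x - ?e\<bar> \<ge> t} = {x. S x - ?e \<ge> t} \<union> {x. - S x - measure_pmf.expectation ?M (\<lambda>x. - S x) \<ge> t}"
    by auto
  also have "measure_pmf.prob ?M \<dots> \<le> measure_pmf.prob ?M {x. S x - ?e \<ge> t}
      + measure_pmf.prob ?M {x. - S x - measure_pmf.expectation ?M (\<lambda>x. - S x) \<ge> t}"
    by (intro measure_Un_le) auto
  also have "\<dots> \<le> exp (- (2 * t\<^sup>2 / v)) + exp (- (2 * t\<^sup>2 / v))"
    using S by (intro add_mono path_law_upper_tail[OF c _ v t]) (auto simp: abs_minus_commute)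
  finally show ?thesis by simp
qed

section \<open>The forest case\<close>

lemma interdep_mat_row_sum_le:
  assumes children: "\<And>i. i < N \<Longrightarrow> card {j. j < N \<and> parent j = Some i} \<le> D"
    and nonroot_kernel: "\<And>i j h. j < N \<Longrightarrow> parent j = Some i \<Longrightarrow> length h = j \<Longrightarrow>
           p j h = P j (h ! i)"
    and root_kernel: "\<And>j h h'. j < N \<Longrightarrow> parent j = None \<Longrightarrow> length h = j \<Longrightarrow> length h' = j \<Longrightarrow>
           p j h = p j h'"
    and H_le: "\<And>i j. j < N \<Longrightarrow> parent j = Some i \<Longrightarrow> interdep_mat N p $$ (i, j) \<le> \<alpha>"
    and "\<alpha> \<ge> 0" and i: "i < N"
  shows "(\<Sum>j<N. interdep_mat N p $$ (i, j)) \<le> \<alpha> * real D"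
proof -
  let ?C = "{j. j < N \<and> parent j = Some i}"
  \<comment> \<open>Changing the symbol at \<open>i\<close> leaves \<open>p j\<close> unchanged: a
    root ignores its history, and any other such \<open>j\<close> reads only position
    \<open>k \<noteq> i\<close>.\<close>
  have zero: "interdep_mat N p $$ (i, j) = 0" if j: "j < N" "parent j \<noteq> Some i" for j
  proof (cases "i < j")
    case True
    have "tv_dist (p j h) (p j (h[i := b])) \<le> 0" if h: "length h = j" for h b
    proof (cases "parent j")
      case None
      then show ?thesis using root_kernel[of j h "h[i := b]"] j h by simp
    next
      case (Some k)
      then show ?thesis using nonroot_kernel[of j k] j h by simp
    qed
    then have "interdep_mat N p $$ (i, j) \<le> 0"
      by (rule interdep_mat_le[OF True j(1)])
    then show ?thesis using interdep_mat_nonneg[OF i j(1), of p] by simp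
  qed (use i j in \<open>simp add: interdep_mat_def\<close>)
  have "(\<Sum>j<N. interdep_mat N p $$ (i, j)) = (\<Sum>j\<in>?C. interdep_mat N p $$ (i, j))"
    by (intro sum.mono_neutral_right) (auto intro: zero)
  also have "\<dots> \<le> (\<Sum>j\<in>?C. \<alpha>)"
    by (intro sum_mono) (auto intro: H_le)
  also have "\<dots> \<le> \<alpha> * real D"
    using children[OF i] \<open>\<alpha> \<ge> 0\<close> by (simp add: mult.commute mult_left_mono)
  finally show ?thesis .
qed

text \<open>A maximum principle: at a site \<open>m\<close> where the absolute value of
  \<open>g\<close> attains its maximum \<open>K\<close>, the recursion and the nonnegativity of
  \<open>H\<close> give \<open>K \<le> 1 + \<rho> * K\<close>.\<close>

lemma Gamma_mat_one_le:
  assumes row: "\<And>i. i < N \<Longrightarrow> (\<Sum>j<N. interdep_mat N p $$ (i, j)) \<le> \<rho>" and "\<rho> < 1" and i: "i < N"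
  shows "\<bar>(Gamma_mat N p *\<^sub>v vec N (\<lambda>_. 1)) $ i\<bar> \<le> 1 / (1 - \<rho>)"
proof -
  define g where "g = Gamma_mat N p *\<^sub>v vec N (\<lambda>_. 1)"
  define K where "K = Max ((\<lambda>i. \<bar>g $ i\<bar>) ` {..<N})"
  have le_K: "\<bar>g $ j\<bar> \<le> K" if "j < N" for j
    unfolding K_def using that by (intro Max_ge) auto
  have K0: "K \<ge> 0" using le_K[OF i] by linarith
  have "K \<in> (\<lambda>i. \<bar>g $ i\<bar>) ` {..<N}"
    unfolding K_def using i by (intro Max_in) auto
  then obtain m where m: "m < N" "K = \<bar>g $ m\<bar>" by auto
  have "g $ m = 1 + (\<Sum>j<N. interdep_mat N p $$ (m, j) * g $ j)"
    using Gamma_mat_mult_index[of "vec N (\<lambda>_. 1)" N m p] m(1) by (simp add: g_def)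
  then have "K \<le> 1 + (\<Sum>j<N. \<bar>interdep_mat N p $$ (m, j) * g $ j\<bar>)"
    using sum_abs[of "\<lambda>j. interdep_mat N p $$ (m, j) * g $ j" "{..<N}"] m(2) by linarith
  also have "(\<Sum>j<N. \<bar>interdep_mat N p $$ (m, j) * g $ j\<bar>) \<le> (\<Sum>j<N. interdep_mat N p $$ (m, j) * K)"
    using m(1) by (intro sum_mono) (auto simp: abs_mult interdep_mat_nonneg intro!: mult_left_mono le_K)
  also have "\<dots> \<le> \<rho> * K"
    using row[OF m(1)] K0 by (simp add: sum_distrib_right[symmetric] mult_right_mono)
  finally have "K * (1 - \<rho>) \<le> 1" by (simp add: algebra_simps)
  then have "K \<le> 1 / (1 - \<rho>)" using \<open>\<rho> < 1\<close> by (simp add: pos_le_divide_eq)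
  then show ?thesis using le_K[OF i] by (simp add: g_def)
qed

theorem proposition4p3:
  fixes N D :: nat
    and p :: "nat \<Rightarrow> 'a :: finite list \<Rightarrow> 'a pmf"
    and P :: "nat \<Rightarrow> 'a \<Rightarrow> 'a pmf"
    and parent :: "nat \<Rightarrow> nat option"
    and \<alpha> :: real
    and f :: "nat \<Rightarrow> 'a \<Rightarrow> real"
    and S :: "'a list \<Rightarrow> real"
  assumes "N \<ge> 1" and "D \<ge> 1"
    and forest: "\<And>i j. j < N \<Longrightarrow> parent j = Some i \<Longrightarrow> i < j"
    and children: "\<And>i. i < N \<Longrightarrow> card {j. j < N \<and> parent j = Some i} \<le> D"
    and nonroot_kernel: "\<And>i j h. j < N \<Longrightarrow> parent j = Some i \<Longrightarrow> length h = j \<Longrightarrow>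
           p j h = P j (h ! i)"
    and root_kernel: "\<And>j h h'. j < N \<Longrightarrow> parent j = None \<Longrightarrow> length h = j \<Longrightarrow> length h' = j \<Longrightarrow>
           p j h = p j h'"
    and H_le: "\<And>i j. j < N \<Longrightarrow> parent j = Some i \<Longrightarrow> interdep_mat N p $$ (i, j) \<le> \<alpha>"
    and "\<alpha> \<ge> 0" and "\<alpha> * real D < 1"
    and f_osc: "\<And>i a b. i < N \<Longrightarrow> \<bar>f i a - f i b\<bar> \<le> 1"
    and S_eq: "\<And>x. S x = (\<Sum>i<N. f i (x ! i))"
  shows "(vec_norm2 (Gamma_mat N p *\<^sub>v vec N (\<lambda>_. 1)))\<^sup>2 \<le> real N / (1 - \<alpha> * real D)\<^sup>2 \<and>
         (\<forall>t>0. measure_pmf.prob (path_law N p)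
                  {x. \<bar>S x - measure_pmf.expectation (path_law N p) S\<bar> \<ge> t}
                \<le> 2 * exp (- (2 * t\<^sup>2 * (1 - \<alpha> * real D)\<^sup>2 / real N)))"
proof -
  let ?\<rho> = "\<alpha> * real D" and ?one = "vec N (\<lambda>_. 1) :: real vec"
  let ?g = "Gamma_mat N p *\<^sub>v ?one"
  have row: "(\<Sum>j<N. interdep_mat N p $$ (i, j)) \<le> ?\<rho>" if "i < N" for i
    using children nonroot_kernel root_kernel H_le \<open>\<alpha> \<ge> 0\<close> that
    by (rule interdep_mat_row_sum_le)
  have g: "?g \<in> carrier_vec N"
    using Gamma_mat_inverse(1)[of N p] by simp
  have "(vec_norm2 ?g)\<^sup>2 = (\<Sum>i<N. (?g $ i)\<^sup>2)"
    by (rule vec_norm2_sq[OF g])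
  also have "\<dots> \<le> (\<Sum>i<N. (1 / (1 - ?\<rho>))\<^sup>2)"
    using Gamma_mat_one_le[OF row \<open>?\<rho> < 1\<close>] \<open>?\<rho> < 1\<close>
    by (intro sum_mono) (simp add: abs_le_square_iff[symmetric])
  also have "\<dots> = real N / (1 - ?\<rho>)\<^sup>2"
    by (simp add: power_divide)
  finally have norm: "(vec_norm2 ?g)\<^sup>2 \<le> real N / (1 - ?\<rho>)\<^sup>2" .
  have S_osc: "\<bar>S x - S (x[i := b])\<bar> \<le> ?one $ i" if "i < N" "length x = N" for i x b
  proof -
    \<comment> \<open>Only summand \<open>i\<close> sees the change, so the all-ones vector bounds
      the oscillations of \<open>S\<close>.\<close>
    have "S x - S (x[i := b]) = (\<Sum>j<N. if j = i then f i (x ! i) - f i b else 0)"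
      unfolding S_eq sum_subtractf[symmetric] using that
      by (intro sum.cong) (auto simp: nth_list_update)
    then show ?thesis using f_osc[OF that(1)] that by simp
  qed
  have pos: "real N / (1 - ?\<rho>)\<^sup>2 > 0"
    using \<open>N \<ge> 1\<close> \<open>?\<rho> < 1\<close> by simp
  show ?thesis
    \<comment> \<open>With \<open>v = N / (1 - \<alpha> D)^2\<close>, the exponent
      \<open>2 t^2 / v\<close> is the claimed one.\<close>
    using norm path_law_concentration[OF _ S_osc norm pos] by simp
qed

end
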